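(* Let $p$ be a prime and $q=1/p$. For integers $n\ge1$, $\mu\ge1$, let $P(n,p^\mu)$ be the probability that a random symmetric $n\times n$ matrix over $\mathbf{Z}_{p^\mu}$ has determinant $\not\equiv 0\pmod{p^\mu}$, and set $P(0,p^\mu)=1$ for $\mu\ge1$. For $n\ge 0$ define the formal power series $\mathcal{P}_n(x)=\sum_{\mu=1}^\infty P(n,p^\mu)x^\mu$. Then for every $k\ge 0$, $$\mathcal{P}_{2k+1}(x)=\Big(\frac{x}{1-x}\Big)\Big(\frac{1-qx^2}{1-qx}\Big)\prod_{j=0}^{k}\Big(\frac{1-q^{2j+1}}{1-q^{2j+1}x^2}\Big)$$ and $$\mathcal{P}_{2k}(x)=\Big(\frac{1-q^{2k+1}x}{1-q^{2k+1}}\Big)\mathcal{P}_{2k+1}(x).$$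
   Context: For a positive integer $m$, $\mathbf{Z}_m=\{1,2,\ldots,m\}$ (viewed as residues mod $m$). A random symmetric $n\times n$ matrix over $\mathbf{Z}_m$ is one whose entries $a_{ij}$, $i\le j$, are chosen independently and uniformly from $\mathbf{Z}_m$, with $a_{ji}=a_{ij}$. *)

theory Defs
  imports "Jordan_Normal_Form.Determinant" "HOL-Computational_Algebra.Formal_Power_Series"
begin

text \<open>Symmetric n x n integer matrices with entries in the residue system {0,...,m-1}
  (a faithful model of symmetric matrices over Z_m: entries a_ij, i \<le> j, free, a_ji = a_ij).\<close>
definition sym_mats :: "nat \<Rightarrow> nat \<Rightarrow> int mat set" where
  "sym_mats n m = {A \<in> carrier_mat n n.
     (\<forall>i<n. \<forall>j<n. A $$ (i,j) = A $$ (j,i) \<and> A $$ (i,j) \<in> {0..<int m})}"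

definition Pnonsing :: "nat \<Rightarrow> nat \<Rightarrow> real" where
  "Pnonsing n m = (if n = 0 then 1 else
     real (card {A \<in> sym_mats n m. \<not> (int m dvd det A)}) / real (card (sym_mats n m)))"

definition Pgf :: "nat \<Rightarrow> nat \<Rightarrow> real fps" where
  "Pgf p n = Abs_fps (\<lambda>\<mu>. if \<mu> = 0 then 0 else Pnonsing n (p ^ \<mu>))"

end

theory Submission
  imports Defs "HOL-Number_Theory.Cong" "HOL-Computational_Algebra.Primes"
begin

text \<open>Write \<open>D(n, \<nu>)\<close> for the probability that \<open>p\<^sup>\<nu>\<close> does not divide the determinant of a uniform
  symmetric matrix, and look at its first row, with corner \<open>a\<close> and border \<open>b\<close>. If \<open>a\<close> is a unit,
  pivoting on it leaves a uniform matrix of size \<open>n - 1\<close>; if \<open>p\<close> divides \<open>a\<close> but not \<open>b\<close>, pivoting on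
  a 2 x 2 block of unit determinant leaves one of size \<open>n - 2\<close>. If \<open>p\<close> divides the row, take \<open>p\<close>
  out of the row: either \<open>a/p\<close> is a unit and can be pivoted on, or \<open>p\<close> also divides the new first
  column, and taking it out returns a uniform matrix of size \<open>n\<close>. This gives
  \<open>D(n, \<nu>) = (1 - q) D(n-1, \<nu>) + q (1 - q\<^bsup>n-1\<^esup>) D(n-2, \<nu>)
     + q\<^bsup>n\<^esup> ((1 - q) D(n-1, \<nu>-1) + q D(n, \<nu>-2))\<close>,
  a recurrence that determines \<open>D\<close> and that the stated power series satisfy.\<close>

subsection \<open>Schur complements and determinants modulo an integer\<close>

text \<open>A Schur complement without division: \<open>B\<close> acts as an adjugate of
  \<open>P\<close>, with \<open>d\<close> in place of the determinant. Multiplying on the left by a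
  block lower triangular matrix of determinant \<open>d ^ k\<close> clears the block
  \<open>R\<close>.\<close>

lemma det_schur_complement:
  fixes P :: "'a :: idom mat"
  assumes P: "P \<in> carrier_mat r r" and B: "B \<in> carrier_mat r r"
    and Q: "Q \<in> carrier_mat r k" and R: "R \<in> carrier_mat k r" and C: "C \<in> carrier_mat k k"
    and BP: "B * P = d \<cdot>\<^sub>m 1\<^sub>m r"
  shows "d ^ k * det (four_block_mat P Q R C) = det P * det (d \<cdot>\<^sub>m C - R * B * Q)"
proof -
  let ?L = "four_block_mat (1\<^sub>m r) (0\<^sub>m r k) (- (R * B)) (d \<cdot>\<^sub>m 1\<^sub>m k)"
  have RB: "R * B \<in> carrier_mat k r" using R B by simp
  have RBP: "R * B * P = d \<cdot>\<^sub>m R"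
    using assoc_mult_mat[OF R B P] BP R by (simp add: mult_smult_distrib[OF R one_carrier_mat])
  have detL: "det ?L = d ^ k"
    using det_four_block_mat_upper_right_zero[of "1\<^sub>m r" r "0\<^sub>m r k" k "- (R * B)" "d \<cdot>\<^sub>m 1\<^sub>m k"] RB
    by simp
  have 1: "1\<^sub>m r * P + 0\<^sub>m r k * R = P"
    using P R by simp
  have 2: "1\<^sub>m r * Q + 0\<^sub>m r k * C = Q"
    using Q C by simp
  have 3: "- (R * B) * P + (d \<cdot>\<^sub>m 1\<^sub>m k) * R = 0\<^sub>m k r"
  proof -
    have "- (R * B) * P = - (d \<cdot>\<^sub>m R)"
      using uminus_mult_left_mat[of "R * B" P] RBP RB P by auto
    moreover have "(d \<cdot>\<^sub>m 1\<^sub>m k) * R = d \<cdot>\<^sub>m R"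
      using R by (simp add: mult_smult_assoc_mat[of _ k k])
    ultimately show ?thesis
      using R by (intro eq_matI) auto
  qed
  have 4: "- (R * B) * Q + (d \<cdot>\<^sub>m 1\<^sub>m k) * C = d \<cdot>\<^sub>m C - R * B * Q"
  proof -
    have "- (R * B) * Q = - (R * B * Q)"
      using uminus_mult_left_mat[of "R * B" Q] RB Q by auto
    moreover have "(d \<cdot>\<^sub>m 1\<^sub>m k) * C = d \<cdot>\<^sub>m C"
      using C by (simp add: mult_smult_assoc_mat[of _ k k])
    ultimately show ?thesis
      using R C B Q by (intro eq_matI) auto
  qed
  have "?L * four_block_mat P Q R C = four_block_mat P Q (0\<^sub>m k r) (d \<cdot>\<^sub>m C - R * B * Q)"
    using mult_four_block_mat[of "1\<^sub>m r" r r "0\<^sub>m r k" k "- (R * B)" k "d \<cdot>\<^sub>m 1\<^sub>m k" P r Q k R C]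
      P Q R C RB unfolding 1 2 3 4 by simp
  then have "det ?L * det (four_block_mat P Q R C)
      = det (four_block_mat P Q (0\<^sub>m k r) (d \<cdot>\<^sub>m C - R * B * Q))"
    using det_mult[of ?L "r + k" "four_block_mat P Q R C"] RB P C by simp
  also have "\<dots> = det P * det (d \<cdot>\<^sub>m C - R * B * Q)"
    by (rule det_four_block_mat_lower_left_zero[OF P Q refl]) (use C R Q B in auto)
  finally show ?thesis by (simp add: detL)
qed

text \<open>The factors \<open>d ^ k\<close> and \<open>det P\<close> of the determinant identity
  are units modulo \<open>M\<close>, so neither affects divisibility by \<open>M\<close>.\<close>

lemma dvd_det_schur_complement:
  fixes P :: "int mat"
  assumes "P \<in> carrier_mat r r" "B \<in> carrier_mat r r"
    "Q \<in> carrier_mat r k" "R \<in> carrier_mat k r" "C \<in> carrier_mat k k"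
    and "B * P = d \<cdot>\<^sub>m 1\<^sub>m r" and cd: "coprime d M" and cP: "coprime (det P) M"
  shows "M dvd det (four_block_mat P Q R C) \<longleftrightarrow> M dvd det (d \<cdot>\<^sub>m C - R * B * Q)"
proof -
  have "M dvd det (four_block_mat P Q R C) \<longleftrightarrow> M dvd d ^ k * det (four_block_mat P Q R C)"
    using cd by (simp add: coprime_dvd_mult_right_iff coprime_commute)
  also have "\<dots> \<longleftrightarrow> M dvd det (d \<cdot>\<^sub>m C - R * B * Q)"
    unfolding det_schur_complement[OF assms(1-6)]
    using cP by (simp add: coprime_dvd_mult_right_iff coprime_commute)
  finally show ?thesis .
qed

lemma cong_det:
  fixes A B :: "int mat"
  assumes A: "A \<in> carrier_mat n n" and B: "B \<in> carrier_mat n n"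
    and AB: "\<And>i j. i < n \<Longrightarrow> j < n \<Longrightarrow> [A $$ (i,j) = B $$ (i,j)] (mod M)"
  shows "[det A = det B] (mod M)"
  unfolding det_def'[OF A] det_def'[OF B]
  by (intro cong_sum cong_mult cong_refl cong_prod AB)
     (auto simp: permutes_in_image dest: permutes_in_image)

lemma dvd_det_cong:
  fixes A B :: "int mat"
  assumes "A \<in> carrier_mat n n" "B \<in> carrier_mat n n"
    and "\<And>i j. i < n \<Longrightarrow> j < n \<Longrightarrow> [A $$ (i,j) = B $$ (i,j)] (mod M)"
  shows "M dvd det A \<longleftrightarrow> M dvd det B"
  using cong_det[OF assms] by (rule cong_dvd_iff)

text \<open>Rows and columns each contribute the sign of \<open>\<pi>\<close>, and the square of a
  sign is 1.\<close>

lemma det_permute_rows_cols: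
  fixes A :: "'a :: comm_ring_1 mat"
  assumes A: "A \<in> carrier_mat n n" and \<pi>: "\<pi> permutes {0..<n}"
  shows "det (mat n n (\<lambda>(i,j). A $$ (\<pi> i, \<pi> j))) = det A"
proof -
  let ?B = "mat n n (\<lambda>(i,j). A $$ (\<pi> i, j))"
  let ?C = "mat n n (\<lambda>(i,j). A $$ (\<pi> i, \<pi> j))"
  have \<pi>lt: "\<pi> i < n" if "i < n" for i
    using permutes_in_image[OF \<pi>, of i] that by simp
  have "det ?C = det (transpose_mat ?C)"
    by (rule det_transpose[symmetric, of _ n]) simp
  also have "transpose_mat ?C = mat n n (\<lambda>(i,j). transpose_mat ?B $$ (\<pi> i, j))"
    by (intro eq_matI) (auto simp: \<pi>lt)
  also have "det \<dots> = signof \<pi> * det (transpose_mat ?B)"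
    by (rule det_permute_rows[OF _ \<pi>]) simp
  also have "det (transpose_mat ?B) = signof \<pi> * det A"
    using det_permute_rows[OF A \<pi>] by (subst det_transpose[of _ n]) auto
  finally show ?thesis by (simp add: sign_def split: if_splits)
qed

section \<open>Symmetric matrices over residues and their affine substitutions\<close>

lemma finite_sym_mats: "finite (sym_mats n m)"
proof -
  let ?F = "({0..<n} \<times> {0..<n}) \<rightarrow>\<^sub>E {0..<int m}"
  have "sym_mats n m \<subseteq> mat n n ` ?F"
  proof
    fix A assume A: "A \<in> sym_mats n m"
    then have "A = mat n n (restrict (\<lambda>ij. A $$ ij) ({0..<n} \<times> {0..<n}))"
      by (intro eq_matI) (auto simp: sym_mats_def)
    moreover have "restrict (\<lambda>ij. A $$ ij) ({0..<n} \<times> {0..<n}) \<in> ?F"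
      using A by (auto simp: sym_mats_def)
    ultimately show "A \<in> mat n n ` ?F" by blast
  qed
  then show ?thesis by (rule finite_subset) (intro finite_imageI finite_PiE; simp)
qed

lemma sym_mats_index_mod:
  assumes "A \<in> sym_mats n m" "i < n" "j < n"
  shows "A $$ (i,j) mod int m = A $$ (i,j)"
  using assms by (auto simp: sym_mats_def)

text \<open>The substitution \<open>C \<mapsto> d C - K\<close> permutes the symmetric matrices modulo \<open>m\<close>.\<close>

lemma card_sym_mats_affine:
  fixes K :: "int mat"
  assumes m: "m > 0" and d: "coprime d (int m)"
    and K: "K \<in> carrier_mat n n" and symK: "\<And>i j. i < n \<Longrightarrow> j < n \<Longrightarrow> K $$ (i,j) = K $$ (j,i)"
    and M: "M dvd int m"
  shows "card {C \<in> sym_mats n m. \<not> M dvd det (d \<cdot>\<^sub>m C - K)} = card {C \<in> sym_mats n m. \<not> M dvd det C}"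
proof -
  define f where "f C = mat n n (\<lambda>(i,j). (d * C $$ (i,j) - K $$ (i,j)) mod int m)" for C
  have f: "f C \<in> sym_mats n m" if "C \<in> sym_mats n m" for C
    using that m symK by (auto simp: sym_mats_def f_def)
  have inj: "inj_on f (sym_mats n m)"
  proof (rule inj_onI)
    fix A B assume A: "A \<in> sym_mats n m" and B: "B \<in> sym_mats n m" and eq: "f A = f B"
    have "A $$ (i,j) = B $$ (i,j)" if ij: "i < n" "j < n" for i j
    proof -
      have "f A $$ (i,j) = f B $$ (i,j)" using eq by simp
      then have "[d * A $$ (i,j) - K $$ (i,j) = d * B $$ (i,j) - K $$ (i,j)] (mod int m)"
        using ij by (simp add: f_def cong_def)
      then have "[d * A $$ (i,j) = d * B $$ (i,j)] (mod int m)"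
        by (simp add: cong_iff_dvd_diff)
      then have "[A $$ (i,j) = B $$ (i,j)] (mod int m)"
        using d by (simp add: cong_mult_lcancel)
      then show ?thesis
        using sym_mats_index_mod[OF A ij] sym_mats_index_mod[OF B ij] by (simp add: cong_def)
    qed
    then show "A = B" using A B by (intro eq_matI) (auto simp: sym_mats_def)
  qed
  have surj: "f ` sym_mats n m = sym_mats n m"
    by (rule endo_inj_surj[OF finite_sym_mats _ inj]) (use f in auto)
  \<comment> \<open>Reducing entries modulo \<open>m\<close> is harmless here because
    \<open>M\<close> divides \<open>m\<close>.\<close>
  have iff: "M dvd det (f C) \<longleftrightarrow> M dvd det (d \<cdot>\<^sub>m C - K)" if "C \<in> sym_mats n m" for C
  proof (rule dvd_det_cong)
    have C: "C \<in> carrier_mat n n" using that by (simp add: sym_mats_def)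
    show "f C \<in> carrier_mat n n" by (simp add: f_def)
    show "d \<cdot>\<^sub>m C - K \<in> carrier_mat n n" using C K by auto
    fix i j assume "i < n" "j < n"
    then have "f C $$ (i,j) = ((d \<cdot>\<^sub>m C - K) $$ (i,j)) mod int m"
      using C K by (simp add: f_def)
    then show "[f C $$ (i,j) = (d \<cdot>\<^sub>m C - K) $$ (i,j)] (mod M)"
      using M by (simp add: cong_def mod_mod_cancel)
  qed
  have "f ` {C \<in> sym_mats n m. \<not> M dvd det (d \<cdot>\<^sub>m C - K)} = {C \<in> f ` sym_mats n m. \<not> M dvd det C}"
    using iff by blast
  then have "f ` {C \<in> sym_mats n m. \<not> M dvd det (d \<cdot>\<^sub>m C - K)} = {C \<in> sym_mats n m. \<not> M dvd det C}"
    unfolding surj .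
  moreover have "card (f ` {C \<in> sym_mats n m. \<not> M dvd det (d \<cdot>\<^sub>m C - K)})
      = card {C \<in> sym_mats n m. \<not> M dvd det (d \<cdot>\<^sub>m C - K)}"
    by (intro card_image inj_on_subset[OF inj]) auto
  ultimately show ?thesis by simp
qed

subsection \<open>Symmetric matrices with a distinguished first row\<close>

text \<open>Row border and column border are separate arguments because symmetry is lost for a
  moment when a factor is taken out of the first row alone.\<close>

definition bordered :: "nat \<Rightarrow> 'a \<Rightarrow> (nat \<Rightarrow> 'a) \<Rightarrow> (nat \<Rightarrow> 'a) \<Rightarrow> 'a mat \<Rightarrow> 'a mat" where
  "bordered n a b b' C = mat (Suc n) (Suc n)
     (\<lambda>(i,j). if i = 0 then if j = 0 then a else b (j - 1)
              else if j = 0 then b' (i - 1) else C $$ (i - 1, j - 1))"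

lemma bordered_carrier [simp]: "bordered n a b b' C \<in> carrier_mat (Suc n) (Suc n)"
  by (simp add: bordered_def)

lemma bordered_eq_four_block_mat:
  assumes "C \<in> carrier_mat n n"
  shows "bordered n a b b' C =
    four_block_mat (mat 1 1 (\<lambda>_. a)) (mat 1 n (\<lambda>(_,j). b j)) (mat n 1 (\<lambda>(i,_). b' i)) C"
  using assms by (intro eq_matI) (auto simp: bordered_def)

lemma det_bordered_scale_row:
  fixes c :: "'a :: comm_ring_1"
  shows "det (bordered n (c * a) (\<lambda>i. c * b i) b' C) = c * det (bordered n a b b' C)"
proof -
  have "bordered n (c * a) (\<lambda>i. c * b i) b' C = multrow 0 c (bordered n a b b' C)"
    by (intro eq_matI) (auto simp: bordered_def)
  then show ?thesis using det_multrow[of 0 "Suc n" "bordered n a b b' C" c] by simp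
qed

lemma det_bordered_transpose:
  fixes a :: "'a :: comm_ring_1"
  assumes "C \<in> carrier_mat n n"
  shows "det (bordered n a b b' C) = det (bordered n a b' b (transpose_mat C))"
proof -
  have "bordered n a b' b (transpose_mat C) = transpose_mat (bordered n a b b' C)"
    using assms by (intro eq_matI) (auto simp: bordered_def)
  then show ?thesis using det_transpose[OF bordered_carrier, of n a b b' C] by simp
qed

lemma det_bordered_scale_col:
  fixes c :: "'a :: comm_ring_1"
  assumes "C \<in> carrier_mat n n"
  shows "det (bordered n (c * a) b (\<lambda>i. c * b' i) C) = c * det (bordered n a b b' C)"
  unfolding det_bordered_transpose[OF assms] by (rule det_bordered_scale_row)

abbreviation borders :: "nat \<Rightarrow> nat \<Rightarrow> (nat \<Rightarrow> int) set" where
  "borders n m \<equiv> {..<n} \<rightarrow>\<^sub>E {0..<int m}"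

text \<open>This is the independence behind the recurrence: corner, border and remaining block of a
  uniform symmetric matrix vary freely. It reduces every count to a sum over first rows.\<close>

lemma bij_betw_bordered:
  "bij_betw (\<lambda>(a,b,C). bordered n a b b C)
     ({0..<int m} \<times> borders n m \<times> sym_mats n m) (sym_mats (Suc n) m)"
proof (rule bij_betwI)
  let ?g = "\<lambda>A. (A $$ (0,0), restrict (\<lambda>j. A $$ (0, Suc j)) {..<n},
                  mat n n (\<lambda>(i,j). A $$ (Suc i, Suc j)))"
  show "(\<lambda>(a,b,C). bordered n a b b C)
      \<in> {0..<int m} \<times> borders n m \<times> sym_mats n m \<rightarrow> sym_mats (Suc n) m"
  proof (rule Pi_I)
    fix x assume x: "x \<in> {0..<int m} \<times> borders n m \<times> sym_mats n m"
    obtain a b C where abC: "x = (a, b, C)" by (rule prod_cases3)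
    have a: "a \<in> {0..<int m}" and b: "b \<in> borders n m" and C: "C \<in> sym_mats n m"
      using x unfolding abC by simp_all
    have "b i \<in> {0..<int m}" if "i < n" for i using PiE_mem[OF b] that by simp
    then have "bordered n a b b C \<in> sym_mats (Suc n) m"
      using a C unfolding sym_mats_def by (auto simp: bordered_def less_Suc_eq_0_disj)
    then show "(\<lambda>(a,b,C). bordered n a b b C) x \<in> sym_mats (Suc n) m" by (simp add: abC)
  qed
  show "?g \<in> sym_mats (Suc n) m \<rightarrow> {0..<int m} \<times> borders n m \<times> sym_mats n m"
  proof (rule Pi_I)
    fix A assume "A \<in> sym_mats (Suc n) m"
    then have *: "A $$ (i,j) = A $$ (j,i) \<and> A $$ (i,j) \<in> {0..<int m}" if "i < Suc n" "j < Suc n" for i j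
      using that by (simp only: sym_mats_def mem_Collect_eq)
    have "mat n n (\<lambda>(i,j). A $$ (Suc i, Suc j)) \<in> sym_mats n m"
      unfolding sym_mats_def using * by simp
    moreover have "restrict (\<lambda>j. A $$ (0, Suc j)) {..<n} \<in> borders n m"
      using * by (intro restrict_PiE_iff[THEN iffD2]) simp
    ultimately show "?g A \<in> {0..<int m} \<times> borders n m \<times> sym_mats n m"
      using * by simp
  qed
  show "?g ((\<lambda>(a,b,C). bordered n a b b C) x) = x"
    if "x \<in> {0..<int m} \<times> borders n m \<times> sym_mats n m" for x
  proof -
    obtain a b C where x: "x = (a, b, C)" by (rule prod_cases3)
    have b: "b \<in> borders n m" and C: "C \<in> carrier_mat n n"
      using that unfolding x sym_mats_def by simp_all
    \<comment> \<open>Borders are extensional functions, so both sides are \<open>undefined\<close>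
      from index \<open>n\<close> on.\<close>
    have "restrict (\<lambda>j. bordered n a b b C $$ (0, Suc j)) {..<n} = b"
      by (rule ext) (simp add: bordered_def PiE_arb[OF b])
    moreover have "mat n n (\<lambda>(i,j). bordered n a b b C $$ (Suc i, Suc j)) = C"
      using C by (intro eq_matI) (auto simp: bordered_def)
    ultimately show ?thesis unfolding x by (simp add: bordered_def)
  qed
  show "(\<lambda>(a,b,C). bordered n a b b C) (?g A) = A" if "A \<in> sym_mats (Suc n) m" for A
  proof -
    have A: "A \<in> carrier_mat (Suc n) (Suc n)" using that by (simp add: sym_mats_def)
    have sym: "A $$ (0, Suc i) = A $$ (Suc i, 0)" if "i < n" for i
      using that \<open>A \<in> sym_mats (Suc n) m\<close> unfolding sym_mats_def mem_Collect_eq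
      by (metis Suc_mono zero_less_Suc)
    show ?thesis
    proof (rule eq_matI)
      fix i j assume "i < dim_row A" "j < dim_col A"
      then show "(\<lambda>(a,b,C). bordered n a b b C) (?g A) $$ (i,j) = A $$ (i,j)"
        using A sym by (cases i; cases j) (simp_all add: bordered_def)
    qed (use A in \<open>simp_all add: bordered_def\<close>)
  qed
qed

section \<open>Counting by the first row\<close>

definition nonsing :: "nat \<Rightarrow> nat \<Rightarrow> int \<Rightarrow> nat" where
  "nonsing n m M = card {C \<in> sym_mats n m. \<not> M dvd det C}"

text \<open>As in \<open>nonsing\<close>, the modulus \<open>m\<close> of the entries and the
  divisor \<open>M\<close> are independent: taking \<open>p\<close> out of the determinant lowers
  \<open>M\<close>, while the entries still range over residues modulo \<open>m\<close>.\<close>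

definition nonsing_bordered :: "nat \<Rightarrow> nat \<Rightarrow> int \<Rightarrow> int \<Rightarrow> (nat \<Rightarrow> int) \<Rightarrow> nat" where
  "nonsing_bordered n m M a b = card {C \<in> sym_mats n m. \<not> M dvd det (bordered n a b b C)}"

lemma sum_sym_mats_Suc:
  fixes f :: "int mat \<Rightarrow> nat"
  shows "(\<Sum>A\<in>sym_mats (Suc n) m. f A)
    = (\<Sum>a\<in>{0..<int m}. \<Sum>b\<in>borders n m. \<Sum>C\<in>sym_mats n m. f (bordered n a b b C))"
  by (simp add: sum.reindex_bij_betw[OF bij_betw_bordered, symmetric] sum.cartesian_product
      case_prod_unfold)

lemma card_filter_eq_sum:
  "finite A \<Longrightarrow> card {x \<in> A. P x} = (\<Sum>x\<in>A. if P x then 1 else 0)"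
  by (simp add: sum.If_cases Int_def)

lemma nonsing_Suc:
  "nonsing (Suc n) m M = (\<Sum>a\<in>{0..<int m}. \<Sum>b\<in>borders n m. nonsing_bordered n m M a b)"
  unfolding nonsing_def nonsing_bordered_def
  by (simp only: card_filter_eq_sum[OF finite_sym_mats] sum_sym_mats_Suc)

lemma card_sym_mats_Suc: "card (sym_mats (Suc n) m) = m * m ^ n * card (sym_mats n m)"
  using bij_betw_same_card[OF bij_betw_bordered, of m n]
  by (simp add: card_cartesian_product card_PiE)

lemma sym_mats_0: "sym_mats 0 m = {1\<^sub>m 0}"
  by (auto simp: sym_mats_def)

lemma card_sym_mats_pos: "m > 0 \<Longrightarrow> card (sym_mats n m) > 0"
  by (induction n) (simp_all add: sym_mats_0 card_sym_mats_Suc)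

section \<open>Elimination with a prescribed first row\<close>

lemma nonsing_bordered_cong_mod:
  assumes a: "[a = a'] (mod M)" and b: "\<And>i. i < n \<Longrightarrow> [b i = b' i] (mod M)"
  shows "nonsing_bordered n m M a b = nonsing_bordered n m M a' b'"
proof -
  have "M dvd det (bordered n a b b C) \<longleftrightarrow> M dvd det (bordered n a' b' b' C)" for C
    by (rule dvd_det_cong[of _ "Suc n"]) (auto simp: bordered_def a b)
  then show ?thesis by (simp add: nonsing_bordered_def)
qed

text \<open>Pivoting on \<open>a\<close> replaces \<open>C\<close> by \<open>a C - K\<close> with
  \<open>K\<close> having entries \<open>c * b i * b j\<close>. This \<open>K\<close> is symmetric
  even though the bordered matrix need not be, so the affine substitution applies. The factor
  \<open>c\<close> is 1 for a direct pivot and \<open>p\<close> after \<open>p\<close> has left the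
  row but not the column.\<close>

lemma card_nonsing_unit_pivot:
  assumes m: "m > 0" and a: "coprime a (int m)" and M: "M dvd int m"
  shows "card {C \<in> sym_mats n m. \<not> M dvd det (bordered n a b (\<lambda>i. c * b i) C)} = nonsing n m M"
proof -
  let ?P = "mat 1 1 (\<lambda>_. a)" and ?Q = "mat 1 n (\<lambda>(_,j). b j)" and ?R = "mat n 1 (\<lambda>(i,_). c * b i)"
  let ?K = "?R * 1\<^sub>m 1 * ?Q"
  have K: "?K $$ (i,j) = c * b i * b j" if "i < n" "j < n" for i j
    using that by (simp add: scalar_prod_def)
  have "1\<^sub>m 1 * ?P = a \<cdot>\<^sub>m 1\<^sub>m 1"
    by (intro eq_matI) (auto simp: scalar_prod_def)
  moreover have aM: "coprime a M"
    by (rule coprime_divisors[OF dvd_refl M a])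
  ultimately have "M dvd det (bordered n a b (\<lambda>i. c * b i) C) \<longleftrightarrow> M dvd det (a \<cdot>\<^sub>m C - ?K)"
    if "C \<in> sym_mats n m" for C
  proof -
    have C: "C \<in> carrier_mat n n" using that by (simp add: sym_mats_def)
    show ?thesis
      unfolding bordered_eq_four_block_mat[OF C]
      by (rule dvd_det_schur_complement[where d = a])
         (use C aM \<open>1\<^sub>m 1 * ?P = a \<cdot>\<^sub>m 1\<^sub>m 1\<close> in \<open>simp_all add: det_single\<close>)
  qed
  then have eq: "{C \<in> sym_mats n m. \<not> M dvd det (bordered n a b (\<lambda>i. c * b i) C)}
      = {C \<in> sym_mats n m. \<not> M dvd det (a \<cdot>\<^sub>m C - ?K)}" by blast
  have Kc: "?K \<in> carrier_mat n n" by (rule carrier_matI) simp_all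
  have Ks: "?K $$ (i,j) = ?K $$ (j,i)" if "i < n" "j < n" for i j
    using K[OF that] K[OF that(2,1)] by simp
  show ?thesis
    unfolding nonsing_def eq by (rule card_sym_mats_affine[OF m a Kc Ks M])
qed

text \<open>The pivot is the leading 2 x 2 block with rows \<open>a, b 0\<close> and
  \<open>b 0, d\<close>. Its adjugate is symmetric, so the correction subtracted from the multiple
  of \<open>C\<close> is symmetric too, and the affine substitution applies again.\<close>

lemma card_nonsing_two_pivot:
  assumes m: "m > 0" and M: "M dvd int m" and co: "coprime (a * d - b 0 * b 0) (int m)"
  shows "card {C \<in> sym_mats n m. \<not> M dvd det (bordered (Suc n) a b b (bordered n d e e C))}
    = nonsing n m M"
proof -
  define \<delta> where "\<delta> = a * d - b 0 * b 0"
  define P where "P = mat 2 2 (\<lambda>(i,j). if i = 0 then if j = 0 then a else b 0 else if j = 0 then b 0 else d)"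
  define B where "B = mat 2 2 (\<lambda>(i,j). if i = 0 then if j = 0 then d else - b 0 else if j = 0 then - b 0 else a)"
  define Q where "Q = mat 2 n (\<lambda>(i,j). if i = 0 then b (Suc j) else e j)"
  have P: "P \<in> carrier_mat 2 2" and B: "B \<in> carrier_mat 2 2" and Q: "Q \<in> carrier_mat 2 n"
    by (simp_all add: P_def B_def Q_def)
  let ?R = "transpose_mat Q"
  let ?K = "?R * B * Q"
  have R: "?R \<in> carrier_mat n 2" using Q by simp
  have BP: "B * P = \<delta> \<cdot>\<^sub>m 1\<^sub>m 2"
    by (intro eq_matI)
       (auto simp: P_def B_def \<delta>_def scalar_prod_def less_2_cases_iff numeral_2_eq_2 algebra_simps)
  \<comment> \<open>Coprimality of \<open>det P\<close> to \<open>M\<close> follows from this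
    product, with no need to evaluate \<open>det P\<close> itself.\<close>
  have "det B * det P = \<delta> ^ 2"
    using det_mult[OF B P] BP by simp
  moreover have \<delta>M: "coprime \<delta> M"
    by (rule coprime_divisors[OF dvd_refl M]) (use co in \<open>simp add: \<delta>_def\<close>)
  ultimately have PM: "coprime (det P) M"
    by (metis coprime_mult_left_iff coprime_power_left_iff)
  have eq: "bordered (Suc n) a b b (bordered n d e e C) = four_block_mat P Q ?R C"
    if "C \<in> carrier_mat n n" for C
  proof (rule eq_matI)
    fix i j assume "i < dim_row (four_block_mat P Q ?R C)" "j < dim_col (four_block_mat P Q ?R C)"
    then have "i < Suc (Suc n)" "j < Suc (Suc n)" using P Q that by auto
    then show "bordered (Suc n) a b b (bordered n d e e C) $$ (i,j) = four_block_mat P Q ?R C $$ (i,j)"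
      using that by (auto simp: bordered_def P_def Q_def less_Suc_eq_0_disj numeral_2_eq_2)
  qed (use P that in \<open>simp_all add: bordered_def\<close>)
  have iff: "M dvd det (bordered (Suc n) a b b (bordered n d e e C))
      \<longleftrightarrow> M dvd det (\<delta> \<cdot>\<^sub>m C - ?K)" if "C \<in> sym_mats n m" for C
  proof -
    have C: "C \<in> carrier_mat n n" using that by (simp add: sym_mats_def)
    show ?thesis unfolding eq[OF C]
      by (rule dvd_det_schur_complement[OF P B Q R C BP \<delta>M PM])
  qed
  have K: "?K \<in> carrier_mat n n" using R B Q by simp
  have Bt: "transpose_mat B = B" by (intro eq_matI) (auto simp: B_def)
  have Kt: "transpose_mat ?K = ?K"
    using transpose_mult[of "?R * B" n 2 Q n] transpose_mult[OF R B] assoc_mult_mat[OF R B Q] R B Q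
    by (simp add: Bt)
  have Ks: "?K $$ (i,j) = ?K $$ (j,i)" if "i < n" "j < n" for i j
  proof -
    have "transpose_mat ?K $$ (i,j) = ?K $$ (j,i)"
      using that Q by simp
    then show ?thesis by (simp only: Kt)
  qed
  have "{C \<in> sym_mats n m. \<not> M dvd det (bordered (Suc n) a b b (bordered n d e e C))}
      = {C \<in> sym_mats n m. \<not> M dvd det (\<delta> \<cdot>\<^sub>m C - ?K)}" using iff by blast
  then show ?thesis
    using card_sym_mats_affine[OF m _ K Ks M, of \<delta>] co by (simp add: nonsing_def \<delta>_def)
qed

text \<open>Swapping two indices in the border is undone by the same swap of rows and columns in
  \<open>C\<close>, which is an involution on the symmetric matrices.\<close>

lemma nonsing_bordered_transpose_border:
  assumes j: "j < n"
  shows "nonsing_bordered n m M a (b \<circ> transpose 0 j) = nonsing_bordered n m M a b"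
proof -
  let ?\<sigma> = "transpose (0::nat) j" and ?\<pi> = "transpose (Suc 0) (Suc j)"
  define f :: "int mat \<Rightarrow> int mat" where "f C = mat n n (\<lambda>(i,k). C $$ (?\<sigma> i, ?\<sigma> k))" for C
  have \<sigma>: "?\<sigma> i < n" if "i < n" for i using that j by (auto simp: transpose_def)
  \<comment> \<open>On the full matrix the swap is shifted by one and fixes the corner.\<close>
  have \<pi>: "?\<pi> 0 = 0" "?\<pi> (Suc i) = Suc (?\<sigma> i)" for i by (auto simp: transpose_def)
  have ff: "f (f C) = C" if "C \<in> sym_mats n m" for C
    using that by (intro eq_matI) (auto simp: f_def \<sigma> sym_mats_def)
  have f: "f C \<in> sym_mats n m" if "C \<in> sym_mats n m" for C
    using that by (auto simp: f_def \<sigma> sym_mats_def)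
  have det: "det (bordered n a (b \<circ> ?\<sigma>) (b \<circ> ?\<sigma>) (f C)) = det (bordered n a b b C)" for C
  proof -
    have "?\<pi> permutes {0..<Suc n}" using j by (intro permutes_swap_id) auto
    from det_permute_rows_cols[OF bordered_carrier this, of a b b C]
    have "det (mat (Suc n) (Suc n) (\<lambda>(i,k). bordered n a b b C $$ (?\<pi> i, ?\<pi> k)))
        = det (bordered n a b b C)" .
    moreover have "mat (Suc n) (Suc n) (\<lambda>(i,k). bordered n a b b C $$ (?\<pi> i, ?\<pi> k))
        = bordered n a (b \<circ> ?\<sigma>) (b \<circ> ?\<sigma>) (f C)"
    proof (rule eq_matI)
      fix i k assume "i < dim_row (bordered n a (b \<circ> ?\<sigma>) (b \<circ> ?\<sigma>) (f C))"
        "k < dim_col (bordered n a (b \<circ> ?\<sigma>) (b \<circ> ?\<sigma>) (f C))"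
      then have "i < Suc n" "k < Suc n" by (simp_all add: bordered_def)
      then show "mat (Suc n) (Suc n) (\<lambda>(i,k). bordered n a b b C $$ (?\<pi> i, ?\<pi> k)) $$ (i,k)
          = bordered n a (b \<circ> ?\<sigma>) (b \<circ> ?\<sigma>) (f C) $$ (i,k)"
        by (cases i; cases k) (simp_all add: bordered_def f_def \<pi> \<sigma>)
    qed (simp_all add: bordered_def)
    ultimately show ?thesis by simp
  qed
  have "bij_betw f {C \<in> sym_mats n m. \<not> M dvd det (bordered n a b b C)}
      {C \<in> sym_mats n m. \<not> M dvd det (bordered n a (b \<circ> ?\<sigma>) (b \<circ> ?\<sigma>) C)}"
  proof (rule bij_betwI[where g = f])
    have "det (bordered n a b b (f C)) = det (bordered n a (b \<circ> ?\<sigma>) (b \<circ> ?\<sigma>) C)"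
      if "C \<in> sym_mats n m" for C
      using det[of "f C"] ff[OF that] by simp
    then show "f \<in> {C \<in> sym_mats n m. \<not> M dvd det (bordered n a (b \<circ> ?\<sigma>) (b \<circ> ?\<sigma>) C)}
        \<rightarrow> {C \<in> sym_mats n m. \<not> M dvd det (bordered n a b b C)}"
      using f by simp
  qed (use f det ff in simp_all)
  then show ?thesis by (simp add: nonsing_bordered_def bij_betw_same_card)
qed

text \<open>The entry \<open>b j\<close> is moved to position 0 and the block is split by its own
  first row \<open>d, e\<close>; each choice of these leaves the same count. Coprimality is asked
  for every \<open>d\<close> because \<open>d\<close> is summed over; it holds when \<open>p\<close>
  divides \<open>a\<close> but not \<open>b j\<close>.\<close>

lemma nonsing_bordered_unit_border:
  assumes m: "m > 0" and M: "M dvd int m" and j: "j < Suc n"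
    and co: "\<And>d. coprime (a * d - b j * b j) (int m)"
  shows "nonsing_bordered (Suc n) m M a b = m * m ^ n * nonsing n m M"
proof -
  let ?b = "b \<circ> transpose 0 j"
  have "nonsing_bordered (Suc n) m M a b = nonsing_bordered (Suc n) m M a ?b"
    by (simp add: nonsing_bordered_transpose_border[OF j])
  also have "\<dots> = (\<Sum>d\<in>{0..<int m}. \<Sum>e\<in>borders n m.
      card {C \<in> sym_mats n m. \<not> M dvd det (bordered (Suc n) a ?b ?b (bordered n d e e C))})"
    unfolding nonsing_bordered_def
    by (simp only: card_filter_eq_sum[OF finite_sym_mats] sum_sym_mats_Suc)
  also have "\<dots> = (\<Sum>d\<in>{0..<int m}. \<Sum>e\<in>borders n m. nonsing n m M)"
    by (intro sum.cong refl card_nonsing_two_pivot[OF m M]) (simp add: co)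
  also have "\<dots> = m * m ^ n * nonsing n m M"
    by (simp add: card_PiE)
  finally show ?thesis .
qed

text \<open>Taking \<open>c\<close> out of the row cancels it from the divisor. The column keeps its
  factor \<open>c\<close>, and the unit pivot lemma allows for this.\<close>

lemma nonsing_bordered_scaled_unit:
  fixes a c M :: int
  assumes "m > 0" "coprime a (int m)" "M dvd int m" "c \<noteq> 0"
  shows "nonsing_bordered n m (c * M) (c * a) (\<lambda>i. c * b i) = nonsing n m M"
  unfolding nonsing_bordered_def det_bordered_scale_row
  using assms card_nonsing_unit_pivot[of m a M n b c] by simp

text \<open>The corner lies in both the first row and the first column, so it must supply
  \<open>c\<close> twice; each border supplies it once.\<close>

lemma nonsing_bordered_scaled_square:
  fixes a c M :: int
  assumes "c \<noteq> 0"
  shows "nonsing_bordered n m (c * (c * M)) (c * (c * a)) (\<lambda>i. c * b i) = nonsing_bordered n m M a b"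
proof -
  have "det (bordered n (c * (c * a)) (\<lambda>i. c * b i) (\<lambda>i. c * b i) C) = c * (c * det (bordered n a b b C))"
    if "C \<in> sym_mats n m" for C
    using that by (simp add: det_bordered_scale_row det_bordered_scale_col sym_mats_def)
  then show ?thesis using assms unfolding nonsing_bordered_def
    by (intro arg_cong[where f = card]) auto
qed

section \<open>Multiplication by a divisor of the modulus\<close>

lemma card_residues_mult_fiber:
  assumes c: "c > 0" and y: "y \<in> {0..<int (c * l)}" "int c dvd y"
  shows "card {x \<in> {0..<int (c * l)}. (int c * x) mod int (c * l) = y} = c"
proof -
  obtain z where z: "y = int c * z" using y by blast
  have z0: "0 \<le> z" "z < int l" using y c by (auto simp: z zero_le_mult_iff)
  \<comment> \<open>Dividing by \<open>c\<close> turns the condition into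
    \<open>x mod l = z\<close>, which has one solution in each of the \<open>c\<close> blocks of
    length \<open>l\<close>.\<close>
  have "{x \<in> {0..<int (c * l)}. (int c * x) mod int (c * l) = y} = (\<lambda>t. z + int l * int t) ` {..<c}"
  proof (intro equalityI subsetI)
    fix x assume "x \<in> {x \<in> {0..<int (c * l)}. (int c * x) mod int (c * l) = y}"
    then have x: "x \<in> {0..<int (c * l)}" and "(int c * x) mod int (c * l) = y" by blast+
    then have "x mod int l = z"
      using c by (simp add: z flip: mult_mod_right)
    then have "x = z + int l * int (nat (x div int l))"
      using x z0 by (auto simp: pos_imp_zdiv_nonneg_iff)
    moreover have "nat (x div int l) < c"
    proof -
      have "x < int c * int l" using x by simp
      moreover have "int l * (x div int l) \<le> x"
        using z0 mult_div_mod_eq[of "int l" x] pos_mod_sign[of "int l" x] by linarith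
      ultimately have "int l * (x div int l) < int l * int c" by (simp add: mult.commute)
      then have "x div int l < int c" using z0 by simp
      then show ?thesis using c by simp
    qed
    ultimately show "x \<in> (\<lambda>t. z + int l * int t) ` {..<c}" by blast
  next
    fix x assume "x \<in> (\<lambda>t. z + int l * int t) ` {..<c}"
    then obtain t where t: "t < c" and x: "x = z + int l * int t" by blast
    have "int l * int t \<le> int l * int (c - 1)" using t by (intro mult_left_mono) auto
    also have "\<dots> = int (c * l) - int l" using c by (simp add: of_nat_diff algebra_simps)
    finally have "x \<in> {0..<int (c * l)}" using z0 by (simp add: x)
    moreover have "(int c * x) mod int (c * l) = y"
      using z0 by (simp add: x z flip: mult_mod_right)
    ultimately show "x \<in> {x \<in> {0..<int (c * l)}. (int c * x) mod int (c * l) = y}" by blast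
  qed
  moreover have "inj_on (\<lambda>t. z + int l * int t) {..<c}" using z0 by (auto intro: inj_onI)
  ultimately show ?thesis by (simp add: card_image)
qed

lemma sum_const_fibers:
  fixes h :: "'b \<Rightarrow> nat"
  assumes "finite X" "finite Y" "\<phi> ` X \<subseteq> Y" "\<And>y. y \<in> Y \<Longrightarrow> card {x \<in> X. \<phi> x = y} = c"
  shows "(\<Sum>x\<in>X. h (\<phi> x)) = c * (\<Sum>y\<in>Y. h y)"
proof -
  have "(\<Sum>x\<in>X. h (\<phi> x)) = (\<Sum>y\<in>Y. \<Sum>x\<in>{x \<in> X. \<phi> x = y}. h (\<phi> x))"
    by (rule sum.group[OF assms(1-3), symmetric])
  also have "\<dots> = (\<Sum>y\<in>Y. c * h y)"
    by (intro sum.cong refl) (simp add: assms(4))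
  finally show ?thesis by (simp add: sum_distrib_left)
qed

lemma finite_residues_dvd: "finite {y \<in> {0..<int m}. c dvd y}"
  by (rule finite_subset[OF _ finite_atLeastLessThan_int[of 0 "int m"]]) auto

lemma residues_mult_mem:
  assumes "c * l > 0"
  shows "(int c * x) mod int (c * l) \<in> {y \<in> {0..<int (c * l)}. int c dvd y}"
proof -
  have "int (c * l) > 0" using assms by (simp only: of_nat_0_less_iff)
  then have "(int c * x) mod int (c * l) \<in> {0..<int (c * l)}"
    using pos_mod_bound pos_mod_sign unfolding atLeastLessThan_iff by blast
  moreover have "int c dvd (int c * x) mod int (c * l)" by (intro dvd_mod) simp_all
  ultimately show ?thesis by blast
qed

text \<open>Multiplication by \<open>c\<close> carries the uniform distribution on residues to the
  uniform one on multiples of \<open>c\<close>. This is what makes a matrix uniform again after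
  \<open>p\<close> has been divided out.\<close>

lemma sum_residues_mult:
  fixes h :: "int \<Rightarrow> nat"
  assumes "c > 0"
  shows "(\<Sum>x\<in>{0..<int (c * l)}. h ((int c * x) mod int (c * l)))
    = c * (\<Sum>y\<in>{y \<in> {0..<int (c * l)}. int c dvd y}. h y)"
proof (rule sum_const_fibers)
  show "(\<lambda>x. (int c * x) mod int (c * l)) ` {0..<int (c * l)} \<subseteq> {y \<in> {0..<int (c * l)}. int c dvd y}"
  proof (rule image_subsetI)
    fix x assume "x \<in> {0..<int (c * l)}"
    then have "0 < int (c * l)" by simp
    then show "(int c * x) mod int (c * l) \<in> {y \<in> {0..<int (c * l)}. int c dvd y}"
      by (intro residues_mult_mem) (simp only: of_nat_0_less_iff)
  qed
  show "finite {y \<in> {0..<int (c * l)}. int c dvd y}"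
    by (rule finite_residues_dvd)
qed (use card_residues_mult_fiber[OF assms] in blast)+

lemma sum_borders_mult:
  fixes h :: "(nat \<Rightarrow> int) \<Rightarrow> nat"
  assumes "c > 0"
  shows "(\<Sum>b\<in>borders n (c * l). h (\<lambda>i\<in>{..<n}. (int c * b i) mod int (c * l)))
    = c ^ n * (\<Sum>b\<in>{..<n} \<rightarrow>\<^sub>E {y \<in> {0..<int (c * l)}. int c dvd y}. h b)"
proof (rule sum_const_fibers)
  let ?m = "int (c * l)"
  let ?\<phi> = "\<lambda>b. \<lambda>i\<in>{..<n}. (int c * b i) mod ?m"
  show "?\<phi> ` borders n (c * l) \<subseteq> {..<n} \<rightarrow>\<^sub>E {y \<in> {0..<?m}. int c dvd y}"
  proof (rule image_subsetI)
    fix b assume b: "b \<in> borders n (c * l)"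
    have "(int c * b i) mod ?m \<in> {y \<in> {0..<?m}. int c dvd y}" if "i < n" for i
    proof -
      have "?m > 0" using PiE_mem[OF b, of i] that by simp
      then show ?thesis by (intro residues_mult_mem) (simp only: of_nat_0_less_iff)
    qed
    then show "?\<phi> b \<in> {..<n} \<rightarrow>\<^sub>E {y \<in> {0..<?m}. int c dvd y}" by simp
  qed
  fix y assume y: "y \<in> {..<n} \<rightarrow>\<^sub>E {y \<in> {0..<?m}. int c dvd y}"
  \<comment> \<open>The map acts on each coordinate separately, so its fiber is a product of
    \<open>n\<close> fibers of size \<open>c\<close>.\<close>
  have "{b \<in> borders n (c * l). ?\<phi> b = y} = (\<Pi>\<^sub>E i\<in>{..<n}. {x \<in> {0..<?m}. (int c * x) mod ?m = y i})"
    (is "?L = ?R")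
  proof (intro equalityI subsetI)
    fix b assume "b \<in> ?L"
    then have b: "b \<in> borders n (c * l)" and \<phi>b: "?\<phi> b = y" by blast+
    have "(int c * b i) mod ?m = y i" if "i < n" for i
      using fun_cong[OF \<phi>b, of i] that by simp
    then show "b \<in> ?R" using b by (simp add: PiE_iff)
  next
    fix b assume "b \<in> ?R"
    then have b: "b \<in> borders n (c * l)" and \<phi>b: "\<And>i. i < n \<Longrightarrow> (int c * b i) mod ?m = y i"
      by (simp_all add: PiE_iff)
    have "?\<phi> b = y" by (rule ext) (simp del: of_nat_mult add: \<phi>b PiE_arb[OF y])
    then show "b \<in> ?L" using b by blast
  qed
  then show "card {b \<in> borders n (c * l). ?\<phi> b = y} = c ^ n"
    using card_residues_mult_fiber[OF assms] PiE_mem[OF y] by (simp add: card_PiE)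
qed (intro finite_PiE finite_residues_dvd finite_atLeastLessThan_int finite_lessThan)+

lemma card_residues_dvd:
  assumes "c > 0"
  shows "card {y \<in> {0..<int (c * l)}. int c dvd y} = l"
proof -
  have "c * l = c * card {y \<in> {0..<int (c * l)}. int c dvd y}"
    using sum_residues_mult[OF assms, of "\<lambda>_. 1" l] by (simp del: of_nat_mult)
  then show ?thesis using assms by simp
qed

subsection \<open>The recurrence for the densities\<close>

lemma coprime_int_prime_power:
  assumes "prime p" "\<not> int p dvd a"
  shows "coprime a (int (p ^ N))"
proof -
  have "coprime (int p) a"
    using assms by (intro prime_imp_coprime) auto
  then show ?thesis by (simp add: coprime_commute)
qed

lemma nonsing_one [simp]: "nonsing n m 1 = 0"
  by (simp add: nonsing_def)

lemma sum_split_filter: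
  fixes f :: "'a \<Rightarrow> nat"
  assumes "finite A" "B \<subseteq> A"
    and "\<And>x. x \<in> A - B \<Longrightarrow> f x = c"
  shows "real (\<Sum>x\<in>A. f x) = (real (card A) - real (card B)) * real c + real (\<Sum>x\<in>B. f x)"
proof -
  have "(\<Sum>x\<in>A. f x) = (\<Sum>x\<in>A - B. f x) + (\<Sum>x\<in>B. f x)"
    using assms(1,2) by (metis sum.subset_diff)
  also have "(\<Sum>x\<in>A - B. f x) = card (A - B) * c"
    using assms(3) by simp
  also have "card (A - B) = card A - card B"
    using assms(1,2) by (metis card_Diff_subset finite_subset)
  finally show ?thesis
    using card_mono[OF assms(1,2)] by (simp add: of_nat_diff)
qed

abbreviation dvd_residues :: "nat \<Rightarrow> nat \<Rightarrow> int set" where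
  "dvd_residues c m \<equiv> {a \<in> {0..<int m}. int c dvd a}"

abbreviation dvd_borders :: "nat \<Rightarrow> nat \<Rightarrow> nat \<Rightarrow> (nat \<Rightarrow> int) set" where
  "dvd_borders c n m \<equiv> {..<n} \<rightarrow>\<^sub>E dvd_residues c m"

text \<open>If \<open>p\<^sup>2\<close> divides the corner and \<open>p\<close> divides the border, then \<open>p\<close> can be divided out of the
  first row and of the first column, which again leaves a uniform symmetric matrix.\<close>

lemma sum_nonsing_bordered_square:
  assumes p: "p > 0" and m: "m = p\<^sup>2 * l" and M: "int p * (int p * M) dvd int m"
  shows "p ^ (n + 2) * (\<Sum>a\<in>dvd_residues (p\<^sup>2) m. \<Sum>b\<in>dvd_borders p n m.
      nonsing_bordered n m (int p * (int p * M)) a b) = nonsing (Suc n) m M"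
proof -
  let ?M = "int p * (int p * M)"
  let ?f = "nonsing_bordered n m ?M"
  have m': "m = p * (p * l)" using m by (simp add: power2_eq_square)
  have "nonsing_bordered n m M a b
      = ?f ((int (p\<^sup>2) * a) mod int m) (\<lambda>i\<in>{..<n}. (int p * b i) mod int m)" for a b
  proof -
    have "nonsing_bordered n m M a b = ?f (int p * (int p * a)) (\<lambda>i. int p * b i)"
      using p by (simp add: nonsing_bordered_scaled_square)
    also have "\<dots> = ?f ((int (p\<^sup>2) * a) mod int m) (\<lambda>i\<in>{..<n}. (int p * b i) mod int m)"
      using M by (intro nonsing_bordered_cong_mod)
        (simp_all add: cong_def mod_mod_cancel power2_eq_square mult.assoc)
    finally show ?thesis .
  qed
  then have "nonsing (Suc n) m M = (\<Sum>a\<in>{0..<int m}. \<Sum>b\<in>borders n m.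
      ?f ((int (p\<^sup>2) * a) mod int m) (\<lambda>i\<in>{..<n}. (int p * b i) mod int m))"
    by (simp add: nonsing_Suc)
  \<comment> \<open>Fibers over the borders have size \<open>p ^ n\<close>; those over the corners,
    in the next step, have size \<open>p^2\<close>. Together they give the exponent
    \<open>n + 2\<close>.\<close>
  also have "\<dots> = (\<Sum>a\<in>{0..<int m}. p ^ n * (\<Sum>b\<in>dvd_borders p n m. ?f ((int (p\<^sup>2) * a) mod int m) b))"
    unfolding m' by (intro sum.cong refl sum_borders_mult p)
  also have "\<dots> = p\<^sup>2 * (\<Sum>a\<in>dvd_residues (p\<^sup>2) m. p ^ n * (\<Sum>b\<in>dvd_borders p n m. ?f a b))"
    using p sum_residues_mult[of "p\<^sup>2" "\<lambda>a. p ^ n * (\<Sum>b\<in>dvd_borders p n m. ?f a b)" l]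
    unfolding m by simp
  also have "\<dots> = p ^ (n + 2) * (\<Sum>a\<in>dvd_residues (p\<^sup>2) m. \<Sum>b\<in>dvd_borders p n m. ?f a b)"
    by (simp add: sum_distrib_left power_add power2_eq_square ac_simps)
  finally show ?thesis ..
qed

text \<open>Exactly one factor \<open>p\<close> sits in the corner: once it leaves the row, the
  corner is a unit and serves as pivot.\<close>

lemma nonsing_bordered_dvd_pivot:
  assumes p: "prime p" and m: "m = p ^ N" and M: "int p * M dvd int m"
    and a: "a \<in> dvd_residues p m" "a \<notin> dvd_residues (p\<^sup>2) m" and b: "b \<in> dvd_borders p n m"
  shows "nonsing_bordered n m (int p * M) a b = nonsing n m M"
proof -
  obtain a' where a': "a = int p * a'" using a by blast
  have "\<not> int p dvd a'"
    using a by (auto simp: a' power2_eq_square)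
  then have "coprime a' (int m)" unfolding m by (rule coprime_int_prime_power[OF p])
  moreover have "M dvd int m" using M by (metis dvd_mult_right)
  moreover have "int p \<noteq> 0" "m > 0" using p by (auto simp: m prime_gt_0_nat)
  ultimately have "nonsing_bordered n m (int p * M) (int p * a') (\<lambda>i. int p * (b i div int p)) = nonsing n m M"
    by (intro nonsing_bordered_scaled_unit)
  moreover have "int p * (b i div int p) = b i" if "i < n" for i
    using PiE_mem[OF b, of i] that by auto
  then have "nonsing_bordered n m (int p * M) (int p * a') (\<lambda>i. int p * (b i div int p))
      = nonsing_bordered n m (int p * M) (int p * a') b"
    by (intro nonsing_bordered_cong_mod) simp_all
  ultimately show ?thesis by (simp add: a')
qed

text \<open>Modulo \<open>p\<close> the first row vanishes; writing it as \<open>p\<close> times a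
  zero row lets the scaling rule show that \<open>p\<close> divides the determinant.\<close>

lemma nonsing_bordered_dvd_zero:
  assumes "p > 0" "a \<in> dvd_residues p m" "b \<in> dvd_borders p n m"
  shows "nonsing_bordered n m (int p) a b = 0"
proof -
  have "[a = int p * 0] (mod int p)" using assms by (simp add: cong_0_iff)
  moreover have "[b i = int p * 0] (mod int p)" if "i < n" for i
    using PiE_mem[OF assms(3), of i] that by (simp add: cong_0_iff)
  ultimately have "nonsing_bordered n m (int p) a b
      = nonsing_bordered n m (int p) (int p * 0) (\<lambda>i. int p * 0)"
    by (intro nonsing_bordered_cong_mod)
  also have "\<dots> = 0"
    unfolding nonsing_bordered_def det_bordered_scale_row by simp
  finally show ?thesis .
qed

text \<open>A first row divisible by \<open>p\<close> has probability \<open>q ^ Suc n\<close>, and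
  its corner avoids \<open>p^2\<close> with conditional probability \<open>1 - q\<close>. The last
  term has no factor \<open>m * m ^ n\<close> because \<open>nonsing (Suc n)\<close> already counts
  first rows.\<close>

lemma sum_nonsing_bordered_dvd:
  assumes p: "prime p" and q: "q = 1 / real p" and m: "m = p ^ N" and \<nu>: "0 < \<nu>" "\<nu> \<le> N"
  shows "real (\<Sum>a\<in>dvd_residues p m. \<Sum>b\<in>dvd_borders p n m. nonsing_bordered n m (int p ^ \<nu>) a b)
    = real (m * m ^ n) * q ^ Suc n * (1 - q) * real (nonsing n m (int p ^ (\<nu> - 1)))
      + q ^ (n + 2) * real (nonsing (Suc n) m (int p ^ (\<nu> - 2)))"
proof (cases "\<nu> = 1")
  case True
  \<comment> \<open>The right side vanishes too: \<open>\<nu> - 1\<close> and the truncated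
    \<open>\<nu> - 2\<close> are both 0, and no determinant escapes divisibility by 1.\<close>
  then have "(\<Sum>a\<in>dvd_residues p m. \<Sum>b\<in>dvd_borders p n m. nonsing_bordered n m (int p ^ \<nu>) a b) = 0"
    using nonsing_bordered_dvd_zero[OF prime_gt_0_nat[OF p], of _ m _ n] by (simp del: PiE_iff)
  then show ?thesis by (simp add: True)
next
  case False
  then obtain \<kappa> where \<kappa>: "\<nu> = Suc (Suc \<kappa>)"
    using \<nu> that[of "\<nu> - 2"] by simp
  have "p\<^sup>2 dvd m" unfolding m using \<nu> \<kappa> by (intro le_imp_power_dvd) simp
  then obtain l where l: "m = p\<^sup>2 * l" by (elim dvdE)
  have m': "m = p * (p * l)" using l by (simp add: power2_eq_square)
  have p0: "p > 0" using p by (rule prime_gt_0_nat)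
  have M: "int p * (int p * int p ^ \<kappa>) dvd int m"
    using \<nu> by (simp add: m \<kappa> le_imp_power_dvd flip: power_Suc)
  let ?f = "nonsing_bordered n m (int p * (int p * int p ^ \<kappa>))"
  let ?F = "\<lambda>a. \<Sum>b\<in>dvd_borders p n m. ?f a b"
  have card1: "card (dvd_residues p m) = p * l" unfolding m' by (rule card_residues_dvd[OF p0])
  have card2: "card (dvd_residues (p\<^sup>2) m) = l"
    unfolding l by (rule card_residues_dvd) (use p0 in simp)
  have cardB: "card (dvd_borders p n m) = (p * l) ^ n"
    by (simp only: card_PiE finite_lessThan card1 prod_constant card_lessThan)
  have "real (\<Sum>a\<in>dvd_residues p m. ?F a)
      = (real (card (dvd_residues p m)) - real (card (dvd_residues (p\<^sup>2) m)))
          * real ((p * l) ^ n * nonsing n m (int p * int p ^ \<kappa>))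
        + real (\<Sum>a\<in>dvd_residues (p\<^sup>2) m. ?F a)"
  proof (rule sum_split_filter)
    show "finite (dvd_residues p m)" by (rule finite_residues_dvd)
    show "dvd_residues (p\<^sup>2) m \<subseteq> dvd_residues p m"
      by (auto simp: power2_eq_square dest: dvd_mult_left)
    fix a assume a: "a \<in> dvd_residues p m - dvd_residues (p\<^sup>2) m"
    have "?F a = (\<Sum>b\<in>dvd_borders p n m. nonsing n m (int p * int p ^ \<kappa>))"
      using a by (intro sum.cong refl nonsing_bordered_dvd_pivot[OF p m M]) blast+
    then show "?F a = (p * l) ^ n * nonsing n m (int p * int p ^ \<kappa>)"
      by (simp only: sum_constant cardB of_nat_id)
  qed
  then have "real (\<Sum>a\<in>dvd_residues p m. ?F a)
      = (real (p * l) - real l) * real ((p * l) ^ n * nonsing n m (int p * int p ^ \<kappa>))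
        + real (\<Sum>a\<in>dvd_residues (p\<^sup>2) m. ?F a)"
    by (simp only: card1 card2)
  moreover have "real (\<Sum>a\<in>dvd_residues (p\<^sup>2) m. ?F a) = q ^ (n + 2) * real (nonsing (Suc n) m (int p ^ \<kappa>))"
  proof -
    have "real (nonsing (Suc n) m (int p ^ \<kappa>))
        = real p ^ (n + 2) * real (\<Sum>a\<in>dvd_residues (p\<^sup>2) m. ?F a)"
      unfolding sum_nonsing_bordered_square[OF p0 l M, of n, symmetric]
      by (simp only: of_nat_mult of_nat_power)
    moreover have "q ^ (n + 2) * real p ^ (n + 2) = 1"
      using p0 by (simp add: q flip: power_mult_distrib)
    ultimately show ?thesis by (simp only: mult.assoc[symmetric] mult_1_left)
  qed
  moreover have "(real (p * l) - real l) * real ((p * l) ^ n * nonsing n m (int p * int p ^ \<kappa>))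
      = real (m * m ^ n) * q ^ Suc n * (1 - q) * real (nonsing n m (int p * int p ^ \<kappa>))"
  proof -
    \<comment> \<open>These are the numbers of residues divisible by \<open>p^2\<close> and by
      \<open>p\<close>; their difference is \<open>m * q * (1 - q)\<close>.\<close>
    have "real l = real m * q ^ 2" "real (p * l) = real m * q"
      using p0 by (simp_all add: q l power2_eq_square)
    moreover have "real ((p * l) ^ n * nonsing n m (int p * int p ^ \<kappa>))
        = real (p * l) ^ n * real (nonsing n m (int p * int p ^ \<kappa>))"
      by (simp only: of_nat_mult[of "(p * l) ^ n"] of_nat_power)
    ultimately show ?thesis
      by (simp only:) (simp add: algebra_simps power_mult_distrib power2_eq_square)
  qed
  moreover have "\<nu> - 1 = Suc \<kappa>" "\<nu> - 2 = \<kappa>" using \<kappa> by simp_all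
  ultimately show ?thesis unfolding \<kappa> by (simp only: power_Suc)
qed

section \<open>Densities and their recurrence\<close>

definition density :: "nat \<Rightarrow> nat \<Rightarrow> int \<Rightarrow> real" where
  "density n m M = real (nonsing n m M) / real (card (sym_mats n m))"

lemma density_one [simp]: "density n m 1 = 0"
  by (simp add: density_def)

lemma density_0:
  assumes "p > 1"
  shows "density 0 m (int p ^ \<nu>) = (if \<nu> = 0 then 0 else 1)"
proof -
  have "int p ^ \<nu> \<noteq> 1" if "\<nu> \<noteq> 0"
    using one_less_power[of "int p" \<nu>, OF _ that[unfolded neq0_conv]] assms
    by (metis less_irrefl of_nat_1 of_nat_less_iff)
  then show ?thesis by (auto simp: density_def nonsing_def sym_mats_0 Collect_conv_if)
qed

text \<open>The terms come from a unit corner, from a non-unit corner with a unit in the border, and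
  from a first row divisible by \<open>p\<close> (the last two). Truncated subtraction is harmless:
  for \<open>n = 0\<close> the factor \<open>1 - q ^ n\<close> is 0, and at exponent 0 the density
  is 0.\<close>

lemma density_Suc:
  assumes p: "prime p" and q: "q = 1 / real p" and m: "m = p ^ N" and \<nu>: "0 < \<nu>" "\<nu> \<le> N"
  shows "density (Suc n) m (int p ^ \<nu>) = (1 - q) * density n m (int p ^ \<nu>)
    + q * (1 - q ^ n) * density (n - 1) m (int p ^ \<nu>)
    + q ^ Suc n * (1 - q) * density n m (int p ^ (\<nu> - 1))
    + q ^ (n + 2) * density (Suc n) m (int p ^ (\<nu> - 2))"
proof -
  let ?f = "nonsing_bordered n m (int p ^ \<nu>)"
  let ?F = "\<lambda>a. \<Sum>b\<in>borders n m. ?f a b"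
  let ?G = "\<lambda>a. \<Sum>b\<in>dvd_borders p n m. ?f a b"
  define S where "S = real (card (sym_mats n m))"
  have p0: "p > 0" using p by (rule prime_gt_0_nat)
  have m0: "m > 0" using p0 by (simp add: m)
  have S: "S > 0" using card_sym_mats_pos[OF m0] by (simp add: S_def)
  have M: "int p ^ \<nu> dvd int m" using \<nu> by (simp add: m le_imp_power_dvd)
  obtain l where l: "m = p * l" using \<nu> unfolding m by (cases N) auto
  have lq: "real l = real m * q" using p0 by (simp add: q l)
  have cardR: "card (dvd_residues p m) = l" unfolding l by (rule card_residues_dvd[OF p0])
  have cardB: "card (dvd_borders p n m) = l ^ n"
    by (simp only: card_PiE finite_lessThan cardR prod_constant card_lessThan)
  have cardB': "card (borders n m) = m ^ n" by (simp add: card_PiE)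
  have F: "real (?F a) = (real m ^ n - real l ^ n) * (S * density (n - 1) m (int p ^ \<nu>))
      + real (?G a)" if a: "a \<in> dvd_residues p m" for a
  proof (cases n)
    \<comment> \<open>The only border is the empty one, which counts as divisible by
      \<open>p\<close>; the coefficient \<open>m^0 - l^0\<close> is 0.\<close>
    case 0
    have "borders n m = dvd_borders p n m" by (simp add: 0)
    then show ?thesis by (simp add: 0)
  next
    case (Suc k)
    have "real (?F a) = (real (card (borders n m)) - real (card (dvd_borders p n m)))
        * real (m * m ^ k * nonsing k m (int p ^ \<nu>)) + real (?G a)"
    proof (rule sum_split_filter)
      show "finite (borders n m)" by (intro finite_PiE) simp_all
      show "dvd_borders p n m \<subseteq> borders n m" by (intro PiE_mono) blast
      fix b assume b: "b \<in> borders n m - dvd_borders p n m"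
      then obtain j where j: "j < n" "\<not> int p dvd b j" by (auto simp: PiE_iff)
      show "?f a b = m * m ^ k * nonsing k m (int p ^ \<nu>)"
        unfolding Suc
      proof (rule nonsing_bordered_unit_border[OF m0 M])
        show "j < Suc k" using j by (simp add: Suc)
        fix d
        have "\<not> int p dvd b j * b j"
          using j p by (simp add: prime_dvd_mult_iff)
        \<comment> \<open>Since \<open>p\<close> divides \<open>a\<close>, this determinant is
          \<open>- b j * b j\<close> modulo \<open>p\<close>, whatever \<open>d\<close> is.\<close>
        then have "\<not> int p dvd a * d - b j * b j"
          using a by (metis (no_types, lifting) dvd_diff_right_iff dvd_mult2 mem_Collect_eq)
        then show "coprime (a * d - b j * b j) (int m)"
          unfolding m by (rule coprime_int_prime_power[OF p])
      qed
    qed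
    moreover have "real (m * m ^ k * nonsing k m (int p ^ \<nu>)) = S * density k m (int p ^ \<nu>)"
      using card_sym_mats_pos[OF m0, of k] by (simp add: S_def density_def Suc card_sym_mats_Suc)
    moreover have "k = n - 1" using Suc by simp
    ultimately show ?thesis by (simp only: cardB cardB' of_nat_power)
  qed
  have "real (nonsing (Suc n) m (int p ^ \<nu>)) = (real (card {0..<int m}) - real (card (dvd_residues p m)))
      * real (m ^ n * nonsing n m (int p ^ \<nu>)) + real (\<Sum>a\<in>dvd_residues p m. ?F a)"
    unfolding nonsing_Suc
  proof (rule sum_split_filter)
    fix a assume "a \<in> {0..<int m} - dvd_residues p m"
    then have "coprime a (int m)" unfolding m by (intro coprime_int_prime_power[OF p]) blast
    then have "?f a b = nonsing n m (int p ^ \<nu>)" for b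
      \<comment> \<open>Here row and column borders agree, so the column factor is 1.\<close>
      using card_nonsing_unit_pivot[OF m0 _ M, of a n b 1] by (simp add: nonsing_bordered_def)
    then show "?F a = m ^ n * nonsing n m (int p ^ \<nu>)" by (simp add: cardB')
  qed auto
  also have "real (\<Sum>a\<in>dvd_residues p m. ?F a)
      = real l * ((real m ^ n - real l ^ n) * (S * density (n - 1) m (int p ^ \<nu>)))
        + real (\<Sum>a\<in>dvd_residues p m. ?G a)"
  proof -
    have "real (\<Sum>a\<in>dvd_residues p m. ?F a) = (\<Sum>a\<in>dvd_residues p m. real (?F a))"
      by (rule of_nat_sum)
    also have "\<dots> = (\<Sum>a\<in>dvd_residues p m.
        (real m ^ n - real l ^ n) * (S * density (n - 1) m (int p ^ \<nu>)) + real (?G a))"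
      using F by (intro sum.cong refl) blast
    also have "\<dots> = real (card (dvd_residues p m)) * ((real m ^ n - real l ^ n) * (S * density (n - 1) m (int p ^ \<nu>)))
        + (\<Sum>a\<in>dvd_residues p m. real (?G a))"
      by (simp only: sum.distrib sum_constant)
    finally show ?thesis by (simp only: cardR of_nat_sum)
  qed
  also have "real (\<Sum>a\<in>dvd_residues p m. ?G a)
      = real (m * m ^ n) * q ^ Suc n * (1 - q) * (S * density n m (int p ^ (\<nu> - 1)))
      + q ^ (n + 2) * (real (m * m ^ n) * S * density (Suc n) m (int p ^ (\<nu> - 2)))"
    unfolding sum_nonsing_bordered_dvd[OF assms] density_def card_sym_mats_Suc S_def
    using card_sym_mats_pos[OF m0, of n] m0 by simp
  also have "real (m ^ n * nonsing n m (int p ^ \<nu>)) = real (m ^ n) * S * density n m (int p ^ \<nu>)"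
    using S by (simp add: density_def S_def)
  finally have "real (nonsing (Suc n) m (int p ^ \<nu>)) = (real (m * m ^ n) * S) *
     ((1 - q) * density n m (int p ^ \<nu>)
    + q * (1 - q ^ n) * density (n - 1) m (int p ^ \<nu>)
    + q ^ Suc n * (1 - q) * density n m (int p ^ (\<nu> - 1))
    + q ^ (n + 2) * density (Suc n) m (int p ^ (\<nu> - 2)))"
    unfolding cardR lq by (simp add: algebra_simps power_mult_distrib)
  moreover have "real (card (sym_mats (Suc n) m)) = real (m * m ^ n) * S"
    by (simp add: card_sym_mats_Suc S_def)
  ultimately show ?thesis
    using S m0 by (simp add: density_def[of "Suc n" m "int p ^ \<nu>"])
qed

subsection \<open>The power series\<close>

definition odd_series :: "real \<Rightarrow> nat \<Rightarrow> real fps" where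
  "odd_series q k = (fps_X / (1 - fps_X)) * ((1 - fps_const q * fps_X ^ 2) / (1 - fps_const q * fps_X)) *
     (\<Prod>j\<in>{0..k}. fps_const (1 - q ^ (2*j+1)) / (1 - fps_const (q ^ (2*j+1)) * fps_X ^ 2))"

definition even_series :: "real \<Rightarrow> nat \<Rightarrow> real fps" where
  "even_series q k =
     fps_const (1 / (1 - q ^ (2*k+1))) * (1 - fps_const (q ^ (2*k+1)) * fps_X) * odd_series q k"

text \<open>Indexing both families by the matrix size lets one recurrence in \<open>n\<close> relate
  them.\<close>

definition det_series :: "real \<Rightarrow> nat \<Rightarrow> real fps" where
  "det_series q n = (if odd n then odd_series q (n div 2) else even_series q (n div 2))"

lemma det_series_even [simp]: "det_series q (2 * k) = even_series q k"
  and det_series_odd [simp]: "det_series q (Suc (2 * k)) = odd_series q k"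
  by (simp_all add: det_series_def)

lemma fps_divide_mult_cancel:
  fixes f g :: "real fps"
  assumes "fps_nth g 0 \<noteq> 0"
  shows "f / g * g = f"
  using assms by (simp add: fps_divide_unit mult.assoc inverse_mult_eq_1)

text \<open>Passing from \<open>k\<close> to \<open>k + 1\<close> adds the single factor with
  exponent \<open>2*k+3\<close>; its denominator is cleared here.\<close>

lemma odd_series_Suc:
  "(1 - fps_const (q ^ (2*k+3)) * fps_X ^ 2) * odd_series q (Suc k)
    = (1 - fps_const (q ^ (2*k+3))) * odd_series q k"
proof -
  let ?f = "fps_const (1 - q ^ (2*k+3))" and ?g = "1 - fps_const (q ^ (2*k+3)) * fps_X ^ 2"
  have "odd_series q (Suc k) = odd_series q k * (?f / ?g)"
    unfolding odd_series_def
    by (simp add: mult.assoc prod.atLeast0_atMost_Suc numeral_3_eq_3 del: power_Suc)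
  then have "?g * odd_series q (Suc k) = odd_series q k * (?f / ?g * ?g)"
    by (simp only: ac_simps)
  also have "?f / ?g * ?g = ?f" by (rule fps_divide_mult_cancel) simp
  also have "?f = 1 - fps_const (q ^ (2*k+3))"
    by (simp only: fps_const_sub[symmetric] fps_const_1_eq_1)
  finally show ?thesis by (simp only: mult.commute)
qed

text \<open>The prefactor cancels \<open>1 - q\<close> and \<open>1 - q X\<close>, and the
  \<open>j = 0\<close> factor cancels \<open>1 - q X^2\<close>. What remains is the series of ones
  from exponent 1 on, matching size 0.\<close>

lemma even_series_0:
  assumes "0 < q" "q < 1"
  shows "even_series q 0 = fps_X / (1 - fps_X)"
proof -
  let ?A = "1 - fps_const q * fps_X :: real fps" and ?B = "1 - fps_const q * fps_X ^ 2 :: real fps"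
  have "even_series q 0 = (fps_const (1 / (1 - q)) * fps_const (1 - q)) * (fps_X / (1 - fps_X))
      * (inverse ?A * ?A) * (inverse ?B * ?B)"
    by (simp add: even_series_def odd_series_def fps_divide_unit ac_simps del: fps_const_mult)
  also have "inverse ?A * ?A = 1" by (rule inverse_mult_eq_1) simp
  also have "inverse ?B * ?B = 1" by (rule inverse_mult_eq_1) simp
  also have "fps_const (1 / (1 - q)) * fps_const (1 - q) = (1 :: real fps)"
    using assms by simp
  finally show ?thesis by simp
qed

text \<open>This is the density recurrence for generating functions: lowering the exponent by 1 or 2
  becomes multiplication by \<open>X\<close> or \<open>X^2\<close>, and the term of size
  \<open>Suc n\<close> is moved to the left.\<close>

lemma det_series_rec:
  assumes q: "0 < q" "q < 1"
  shows "(1 - fps_const (q ^ (n + 2)) * fps_X ^ 2) * det_series q (Suc n)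
    = fps_const (1 - q) * (1 + fps_const (q ^ Suc n) * fps_X) * det_series q n
      + fps_const (q * (1 - q ^ n)) * det_series q (n - 1)"
proof -
  define c :: "real \<Rightarrow> real fps" where "c = fps_const"
  have c_diff: "c (1 - a) = 1 - c a" for a by (simp add: c_def flip: fps_const_sub)
  have c_mult: "c (a * b) = c a * c b" for a b by (simp add: c_def)
  have c_inv: "c (1 / (1 - q ^ j)) * (1 - c (q ^ j)) = 1" if "j > 0" for j
  proof -
    have "q ^ j < 1" using q that by (simp add: power_less_one_iff)
    then show ?thesis by (simp add: c_mult[symmetric] flip: c_diff) (simp add: c_def)
  qed
  show ?thesis
  proof (cases "even n")
    case True
    then obtain k where k: "n = 2 * k" by (elim evenE)
    define T S u where "T = c (q ^ (2*k+1))" and "S = c (q ^ (2*k))" and "u = c (1 / (1 - q ^ (2*k+1)))"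
    let ?Q = "c q" and ?X = "fps_X :: real fps" and ?O = "odd_series q k"
    have T: "T = ?Q * S" by (simp add: T_def S_def c_def)
    have u: "u * (1 - T) = 1" unfolding u_def T_def by (rule c_inv) simp
    have E: "even_series q k = u * (1 - T * ?X) * ?O"
      by (simp add: even_series_def u_def T_def c_def)
    \<comment> \<open>The factor \<open>1 - S\<close> covers \<open>k = 0\<close>, where
      \<open>S = 1\<close> and \<open>n - 1\<close> truncates to 0. For larger \<open>k\<close> the
      preceding odd series is expressed through \<open>?O\<close>.\<close>
    have prev: "(1 - S) * det_series q (n - 1) = (1 - S) * (u * (1 - T * ?X ^ 2) * ?O)"
    proof (cases k)
      case 0
      then show ?thesis by (simp add: S_def c_def)
    next
      case (Suc k')
      have "(1 - T * ?X ^ 2) * ?O = (1 - T) * odd_series q k'"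
        using odd_series_Suc[of q k'] by (simp add: T_def c_def Suc numeral_3_eq_3 del: power_Suc)
      then have "u * (1 - T * ?X ^ 2) * ?O = (u * (1 - T)) * odd_series q k'"
        by (simp only: mult.assoc)
      moreover have "n - 1 = Suc (2 * k')" using k Suc by simp
      ultimately show ?thesis by (simp only: u det_series_odd) simp
    qed
    \<comment> \<open>Inserting \<open>u * (1 - T) = 1\<close> gives every term the common factor
      \<open>u * ?O\<close>. A polynomial identity in \<open>Q\<close>, \<open>S\<close> and
      \<open>X\<close> remains, using \<open>T = Q * S\<close>.\<close>
    have "(1 - ?Q * T * ?X ^ 2) * ?O = (u * (1 - T)) * ((1 - ?Q * T * ?X ^ 2) * ?O)"
      by (simp only: u mult_1_left)
    also have "\<dots> = (1 - ?Q) * (1 + T * ?X) * (u * (1 - T * ?X) * ?O)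
        + ?Q * ((1 - S) * (u * (1 - T * ?X ^ 2) * ?O))"
      unfolding T by (simp add: algebra_simps power2_eq_square)
    finally have "(1 - ?Q * T * ?X ^ 2) * ?O = (1 - ?Q) * (1 + T * ?X) * even_series q k
        + ?Q * (1 - S) * det_series q (n - 1)"
      by (simp only: prev E mult.assoc)
    then show ?thesis
      by (simp add: k c_diff[unfolded c_def] T_def S_def c_def mult.assoc flip: fps_const_mult)
  next
    case False
    then obtain k where k: "n = Suc (2 * k)" by (elim oddE) simp
    define T V u v where "T = c (q ^ (2*k+1))" and "V = c (q ^ (2*k+3))"
      and "u = c (1 / (1 - q ^ (2*k+1)))" and "v = c (1 / (1 - q ^ (2*k+3)))"
    let ?Q = "c q" and ?X = "fps_X :: real fps" and ?O = "odd_series q k" and ?O' = "odd_series q (Suc k)"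
    have V: "V = ?Q * ?Q * T" by (simp add: T_def V_def c_def numeral_3_eq_3 mult.assoc)
    have u: "u * (1 - T) = 1" unfolding u_def T_def by (rule c_inv) simp
    have v: "v * (1 - V) = 1" unfolding v_def V_def by (rule c_inv) simp
    have E: "even_series q k = u * (1 - T * ?X) * ?O"
      by (simp add: even_series_def u_def T_def c_def)
    have E': "even_series q (Suc k) = v * (1 - V * ?X) * ?O'"
      by (simp add: even_series_def v_def V_def c_def numeral_3_eq_3 del: power_Suc)
    have O': "(1 - V * ?X ^ 2) * ?O' = (1 - V) * ?O"
      using odd_series_Suc[of q k] by (simp only: V_def c_def)
    have "(1 - V * ?X ^ 2) * even_series q (Suc k) = v * (1 - V * ?X) * ((1 - V * ?X ^ 2) * ?O')"
      unfolding E' by (simp only: ac_simps)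
    also have "\<dots> = (v * (1 - V)) * (1 - V * ?X) * ?O"
      unfolding O' by (simp only: ac_simps)
    also have "\<dots> = (1 - V * ?X) * ?O"
      by (simp only: v mult_1_left)
    \<comment> \<open>With \<open>V = Q * Q * T\<close> this splits \<open>1 - V * X\<close>; the
      second summand is then rewritten as the even series by inserting
      \<open>u * (1 - T) = 1\<close>.\<close>
    also have "\<dots> = (1 - ?Q) * (1 + ?Q * T * ?X) * ?O + ?Q * (1 - T * ?X) * ?O"
      unfolding V by (simp add: algebra_simps)
    also have "?Q * (1 - T * ?X) * ?O = ?Q * (u * (1 - T)) * (1 - T * ?X) * ?O"
      by (simp only: u mult_1_right)
    also have "\<dots> = ?Q * (1 - T) * even_series q k"
      unfolding E by (simp only: ac_simps)
    finally have *: "(1 - V * ?X ^ 2) * even_series q (Suc k)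
        = (1 - ?Q) * (1 + ?Q * T * ?X) * ?O + ?Q * (1 - T) * even_series q k" .
    have "V = fps_const (q ^ (n + 2))" "?Q * T = fps_const (q ^ Suc n)"
      "?Q * (1 - T) = fps_const (q * (1 - q ^ n))" "1 - ?Q = fps_const (1 - q)"
      "det_series q (Suc n) = even_series q (Suc k)" "det_series q n = ?O"
      "det_series q (n - 1) = even_series q k"
      using det_series_even[of q "Suc k"] det_series_even[of q k]
      by (simp_all add: k V_def T_def c_def numeral_3_eq_3 c_diff[unfolded c_def] flip: fps_const_mult
          del: det_series_even)
    then show ?thesis using * by simp
  qed
qed

section \<open>Comparing coefficients with densities\<close>

lemma det_series_nth_0: "fps_nth (det_series q n) 0 = 0"
proof -
  have "fps_nth (odd_series q k) 0 = 0" for k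
    by (simp add: odd_series_def fps_divide_unit)
  then show ?thesis by (simp add: det_series_def even_series_def)
qed

text \<open>Truncated indices \<open>\<nu> - 1\<close> and \<open>\<nu> - 2\<close> read the
  constant coefficient, which is 0, just as the shifts by \<open>X\<close> and \<open>X^2\<close>
  require.\<close>

lemma det_series_nth_Suc:
  assumes q: "0 < q" "q < 1"
  shows "fps_nth (det_series q (Suc n)) \<nu> = (1 - q) * fps_nth (det_series q n) \<nu>
    + q * (1 - q ^ n) * fps_nth (det_series q (n - 1)) \<nu>
    + q ^ Suc n * (1 - q) * fps_nth (det_series q n) (\<nu> - 1)
    + q ^ (n + 2) * fps_nth (det_series q (Suc n)) (\<nu> - 2)"
proof -
  have "det_series q (Suc n) = fps_const (1 - q) * det_series q n
      + fps_const (q * (1 - q ^ n)) * det_series q (n - 1)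
      + fps_const (1 - q) * (fps_const (q ^ Suc n) * (fps_X * det_series q n))
      + fps_const (q ^ (n + 2)) * (fps_X ^ 2 * det_series q (Suc n))"
  proof -
    have "D = B * w + r + B * (T * (fps_X * w)) + A * (Y * D)"
      if "(1 - A * Y) * D = B * (1 + T * fps_X) * w + r" for A B D T Y w r :: "real fps"
      using that by (simp add: algebra_simps)
    from this[OF det_series_rec[OF q, of n]] show ?thesis .
  qed
  from arg_cong[OF this, of "\<lambda>f. fps_nth f \<nu>"] show ?thesis
    using det_series_nth_0 by (auto simp add: fps_X_power_mult_nth not_less)
qed

text \<open>Both sides satisfy the same recurrence with the same initial values. The induction is on
  the size and, inside it, on the exponent, because size \<open>Suc n\<close> recurs at exponent
  \<open>\<nu> - 2\<close>. The ambient modulus \<open>p ^ N\<close> stays fixed throughout.\<close>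

lemma density_eq_det_series:
  assumes p: "prime p" and q: "q = 1 / real p" and m: "m = p ^ N"
  shows "\<nu> \<le> N \<Longrightarrow> density n m (int p ^ \<nu>) = fps_nth (det_series q n) \<nu>"
proof (induction n arbitrary: \<nu> rule: less_induct)
  case (less n)
  have q01: "0 < q" "q < 1" using prime_gt_1_nat[OF p] by (simp_all add: q)
  show ?case
  proof (cases n)
    case 0
    have "fps_nth (fps_X / (1 - fps_X) :: real fps) \<nu> = (if \<nu> = 0 then 0 else 1)"
      by (simp add: fps_divide_unit fps_inverse_gp'[symmetric])
    then show ?thesis
      using det_series_even[of q 0] even_series_0[OF q01] density_0[OF prime_gt_1_nat[OF p]]
      by (simp add: 0)
  next
    case (Suc n')
    have *: "density n'' m (int p ^ \<nu>) = fps_nth (det_series q n'') \<nu>" if "n'' \<le> n'" "\<nu> \<le> N" for n'' \<nu>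
      using less.IH that Suc by simp
    show ?thesis using less.prems unfolding Suc
    proof (induction \<nu> rule: less_induct)
      case (less \<nu>)
      show ?case
      proof (cases "\<nu> = 0")
        case True
        then show ?thesis by (simp add: det_series_nth_0)
      next
        case False
        then have \<nu>: "0 < \<nu>" "\<nu> - 2 < \<nu>" by simp_all
        show ?thesis
          unfolding density_Suc[OF p q m \<nu>(1) less.prems] det_series_nth_Suc[OF q01, of n' \<nu>]
          using less.IH[OF \<nu>(2)] less.prems by (simp add: *)
      qed
    qed
  qed
qed

lemma Pgf_eq_det_series:
  assumes p: "prime p" and q: "q = 1 / real p"
  shows "Pgf p n = det_series q n"
proof (rule fps_ext)
  fix \<mu>
  \<comment> \<open>Here ambient modulus and divisor coincide, that is \<open>N = \<mu>\<close>. For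
    size 0 the convention in \<open>Pnonsing\<close> agrees with the empty determinant being
    1.\<close>
  have "Pnonsing n (p ^ \<mu>) = density n (p ^ \<mu>) (int p ^ \<mu>)" if "\<mu> > 0"
  proof (cases "n = 0")
    case True
    then show ?thesis
      using density_0[OF prime_gt_1_nat[OF p]] that by (simp add: Pnonsing_def)
  qed (simp add: Pnonsing_def density_def nonsing_def)
  then show "fps_nth (Pgf p n) \<mu> = fps_nth (det_series q n) \<mu>"
    using density_eq_det_series[OF assms refl order_refl, of n \<mu>]
    by (simp add: Pgf_def det_series_nth_0)
qed

theorem theorem4p2:
  fixes p k :: nat and q :: real
  assumes "prime p" and "q = 1 / real p"
  shows "(Pgf p (2*k+1) =
           (fps_X / (1 - fps_X)) * ((1 - fps_const q * fps_X ^ 2) / (1 - fps_const q * fps_X)) *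
           (\<Prod>j\<in>{0..k}. fps_const (1 - q ^ (2*j+1)) / (1 - fps_const (q ^ (2*j+1)) * fps_X ^ 2))) \<and>
         (Pgf p (2*k) =
           fps_const (1 / (1 - q ^ (2*k+1))) * (1 - fps_const (q ^ (2*k+1)) * fps_X) * Pgf p (2*k+1))"
proof -
  have odd: "Pgf p (2*k+1) = odd_series q k" and even: "Pgf p (2*k) = even_series q k"
    by (simp_all add: Pgf_eq_det_series[OF assms])
  show ?thesis
    unfolding odd even even_series_def by (simp only: odd_series_def)
qed

end
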